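(* Let $p$ be an odd prime number such that $p+2$ and $p+4$ are not prime and $p=5^{\alpha}-6$ for some natural number $\alpha$. If $m$ is the number of nonisomorphic finite groups of order $5^{\alpha}$, then $h_{OD}(A_{p+6})\geq m+1$ and $h_{OD}(S_{p+6})\geq m+1$.
   Context: All groups are finite. $A_n$ and $S_n$ denote the alternating and symmetric groups of degree $n$. For a finite group $G$, $\pi(G)$ is the set of prime divisors of $|G|$. The prime graph $GK(G)$ is the graph with vertex set $\pi(G)$ in which two distinct primes $r,s\in\pi(G)$ are adjacent if and only if $G$ contains an element of order $rs$. Writing $\pi(G)=\{p_1,\ldots,p_k\}$ with $p_1<p_2<\cdots<p_k$, the degree pattern of $G$ is the tuple $D(G)=(\deg(p_1),\deg(p_2),\ldots,\deg(p_k))$, where $\deg(p_i)$ is the degree of the vertex $p_i$ in $GK(G)$. For a finite group $G$, $h_{OD}(G)$ denotes the number of pairwise nonisomorphic finite groups $H$ (i.e. the number of isomorphism classes, including that of $G$ itself) such that $|H|=|G|$ and $D(H)=D(G)$. *)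

theory Defs
  imports "HOL-Algebra.Algebra" "HOL-Computational_Algebra.Primes"
begin

definition group_primes :: "('a, 'b) monoid_scheme \<Rightarrow> nat set" where
  "group_primes G = {p. normalization_semidom_class.prime p \<and> p dvd order G}"

text \<open>The prime graph has vertex set \<open>group_primes G\<close>; adjacency is irreflexive and
  symmetric, and relates vertices only.\<close>

definition prime_graph_adj :: "('a, 'b) monoid_scheme \<Rightarrow> nat \<Rightarrow> nat \<Rightarrow> bool" where
  "prime_graph_adj G r s \<longleftrightarrow>
     r \<in> group_primes G \<and> s \<in> group_primes G \<and> r \<noteq> s \<and>
     (\<exists>x \<in> carrier G. group.ord G x = r * s)"

definition prime_graph_degree :: "('a, 'b) monoid_scheme \<Rightarrow> nat \<Rightarrow> nat" where
  "prime_graph_degree G r = card {s. prime_graph_adj G r s}"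

definition degree_pattern :: "('a, 'b) monoid_scheme \<Rightarrow> nat list" where
  "degree_pattern G = map (prime_graph_degree G) (sorted_list_of_set (group_primes G))"

text \<open>Isomorphism classes of finite groups cannot be collected over all carrier types at once.
  Every finite group is isomorphic to one whose carrier consists of natural numbers, so the
  groups below are taken with carriers of that kind. For a fixed order there are only
  finitely many classes, so \<^const>\<open>card\<close> does not hit its default value \<open>0\<close> for
  infinite sets in the two definitions that use \<open>num_iso_classes\<close>.\<close>

definition num_iso_classes :: "nat monoid set \<Rightarrow> nat" where
  "num_iso_classes S = card (S // {(H, K). H \<in> S \<and> K \<in> S \<and> H \<cong> K})"

definition num_groups_of_order :: "nat \<Rightarrow> nat" where
  "num_groups_of_order n =
     num_iso_classes {H. group H \<and> finite (carrier H) \<and> order H = n}"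

definition h_OD :: "('a, 'b) monoid_scheme \<Rightarrow> nat" where
  "h_OD G = num_iso_classes {H. group H \<and> finite (carrier H) \<and> order H = order G \<and>
     degree_pattern H = degree_pattern G}"

end

theory Submission
  imports Defs
begin

text \<open>
  Write \<open>n = p + 6 = 5\<^sup>\<alpha>\<close> and let \<open>F n\<close> be \<open>A\<^sub>n\<close> or \<open>S\<^sub>n\<close>. Groups that share order and
  degree pattern with \<open>F n\<close> include \<open>F n\<close> itself and \<open>F (n - 1) \<times> Q\<close> for \<open>Q\<close> of order \<open>5\<^sup>\<alpha>\<close>.
  Every prime \<open>q \<le> n\<close> satisfies \<open>q \<le> p\<close>, so in \<open>F n\<close> the prime 2 is adjacent to all others, and odd
  primes \<open>r \<noteq> s\<close> are adjacent iff \<open>r + s \<le> n\<close>; as \<open>n\<close> is odd this means \<open>r + s \<le> n - 1\<close>, and 5 is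
  adjacent to everything. Hence neither passing to \<open>F (n - 1)\<close> nor multiplying by a 5-group alters
  the prime graph. Since \<open>F k\<close> is generated, up to squares, by 3-cycles, it has no nontrivial
  homomorphism to a group of order coprime to 6; this shows that \<open>Q\<close> can be recovered from
  \<open>F (n - 1) \<times> Q\<close> and that the latter is not isomorphic to \<open>F n\<close>.
\<close>

hide_const (open) Divisibility.prime Multiset.mult

subsection \<open>Orders of elements\<close>

text \<open>If \<open>a \<otimes> b\<close> has trivial \<open>k\<close>-th power, raising further
  to \<open>ord b\<close> removes the contribution of \<open>b\<close>, so \<open>ord a\<close>
  divides \<open>k * ord b\<close> and by coprimality \<open>k\<close>. The other factor is
  symmetric.\<close>

lemma (in group) ord_mult_coprime:
  assumes a: "a \<in> carrier G" and b: "b \<in> carrier G" and comm: "a \<otimes> b = b \<otimes> a"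
    and cop: "coprime (ord a) (ord b)"
  shows "ord (a \<otimes> b) = ord a * ord b"
proof (rule dvd_antisym[OF ord_mul_divides[OF comm a b]])
  have pow: "(a \<otimes> b) [^] k = a [^] k \<otimes> b [^] k" for k :: nat
    using a b comm by (rule pow_mult_distrib[rotated])
  have "ord a dvd k \<and> ord b dvd k" if "(a \<otimes> b) [^] k = \<one>" for k :: nat
  proof
    have one: "a [^] (k * j) \<otimes> b [^] (k * j) = \<one>" for j :: nat
      using that a b by (metis m_closed nat_pow_one nat_pow_pow pow)
    have "b [^] (k * ord b) = \<one>" "a [^] (k * ord a) = \<one>"
      using a b by (simp_all add: pow_eq_id)
    then have "a [^] (k * ord b) = \<one>" "b [^] (k * ord a) = \<one>"
      using one[of "ord b"] one[of "ord a"] a b by auto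
    then have "ord a dvd k * ord b" "ord b dvd k * ord a"
      using a b by (simp_all add: pow_eq_id)
    then show "ord a dvd k" "ord b dvd k"
      using cop by (simp_all add: coprime_dvd_mult_left_iff coprime_commute)
  qed
  from this[of "ord (a \<otimes> b)"] show "ord a * ord b dvd ord (a \<otimes> b)"
    using a b cop by (simp add: divides_mult)
qed

lemma (in group) ord_eq_prime:
  assumes "x \<in> carrier G" "prime r" "x [^] r = \<one>" "x \<noteq> \<one>"
  shows "ord x = r"
  using assms by (metis ord_eq_1 pow_eq_id prime_nat_iff)

lemma (in group) eq_one_if_pow_coprime_order:
  assumes "finite (carrier G)" "x \<in> carrier G" "x [^] k = \<one>" "coprime k (order G)"
  shows "x = \<one>"
proof -
  have "ord x dvd k" "ord x dvd order G"
    using assms by (auto simp: ord_dvd_group_order pow_eq_id)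
  then have "ord x = 1"
    using assms(4) by (meson coprime_common_divisor_nat)
  then show ?thesis
    using assms(2) ord_eq_1 by simp
qed

section \<open>Isomorphism invariance of the prime graph\<close>

lemma ord_inj_hom:
  assumes "h \<in> hom G H" "inj_on h (carrier G)" "group G" "group H" "x \<in> carrier G"
  shows "group.ord H (h x) = group.ord G x"
proof -
  interpret group_hom G H h
    using assms by (simp add: group_hom_def group_hom_axioms_def)
  have "h x [^]\<^bsub>H\<^esub> n = \<one>\<^bsub>H\<^esub> \<longleftrightarrow> x [^]\<^bsub>G\<^esub> n = \<one>\<^bsub>G\<^esub>" for n :: nat
    using assms(2,5) by (metis G.nat_pow_closed G.one_closed hom_nat_pow hom_one inj_onD)
  then show ?thesis
    using assms(5) by (simp add: H.ord_unique G.pow_eq_id)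
qed

lemma iso_imp_prime_graph_adj_eq:
  assumes "G \<cong> H" "group G" "group H"
  shows "prime_graph_adj G = prime_graph_adj H"
proof -
  obtain h where h: "h \<in> hom G H" "inj_on h (carrier G)" "h ` carrier G = carrier H"
    using assms(1) by (auto simp: is_iso_def iso_iff)
  have "order G = order H"
    using assms(1) by (simp add: order_def iso_same_card)
  moreover have "(\<exists>x\<in>carrier H. group.ord H x = n) \<longleftrightarrow> (\<exists>x\<in>carrier G. group.ord G x = n)" for n
    using ord_inj_hom[OF h(1,2) assms(2,3)] by (force simp flip: h(3))
  ultimately show ?thesis
    by (intro ext) (simp add: prime_graph_adj_def group_primes_def)
qed

text \<open>The groups constructed below share the whole prime graph with \<open>F n\<close>, which
  is more than sharing the degrees.\<close>

lemma degree_pattern_cong: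
  assumes "order G = order H" "prime_graph_adj G = prime_graph_adj H"
  shows "degree_pattern G = degree_pattern H"
proof -
  have "prime_graph_degree G = prime_graph_degree H"
    by (intro ext) (simp add: prime_graph_degree_def assms(2))
  then show ?thesis
    by (simp add: degree_pattern_def group_primes_def assms(1))
qed

subsection \<open>Counting isomorphism classes\<close>

text \<open>Moves permutation groups and direct products to the carriers that \<open>h_OD\<close>
  counts.\<close>

lemma ex_iso_nat_group:
  assumes "group G" "finite (carrier G)"
  shows "\<exists>H :: nat monoid. group H \<and> finite (carrier H) \<and> G \<cong> H"
proof -
  interpret group G by fact
  obtain f :: "'a \<Rightarrow> nat" where f: "inj_on f (carrier G)"
    using finite_imp_inj_to_nat_seg[OF assms(2)] by blast
  have "G \<cong> image_group f G"
    using inj_imp_image_group_iso[OF f] by (rule is_isoI)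
  then show ?thesis
    using inj_imp_image_group_is_group[OF f] assms(2)
    by (metis finite_imageI image_group_carrier)
qed

lemma equiv_iso:
  assumes "\<And>H. H \<in> S \<Longrightarrow> group H"
  shows "equiv S {(H, K). H \<in> S \<and> K \<in> S \<and> H \<cong> K}"
proof (rule equivI)
  show "sym {(H, K). H \<in> S \<and> K \<in> S \<and> H \<cong> K}"
    using assms group.iso_sym by (fastforce intro: symI)
  show "trans {(H, K). H \<in> S \<and> K \<in> S \<and> H \<cong> K}"
    by (auto intro: transI iso_trans)
qed (auto simp: refl_on_def)

text \<open>Every group of order \<open>N\<close> is isomorphic to a multiplication table on
  \<open>{..<N}\<close>, and there are finitely many tables. This keeps \<open>card\<close> away
  from its default value 0.\<close>

lemma finite_iso_classes:
  fixes S :: "nat monoid set"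
  assumes "\<And>H. H \<in> S \<Longrightarrow> group H \<and> finite (carrier H) \<and> order H = N"
  shows "finite (S // {(H, K). H \<in> S \<and> K \<in> S \<and> H \<cong> K})"
proof -
  \<comment> \<open>\<open>M t\<close> is an arbitrary table with an arbitrary marked unit, not
    necessarily a group. Extensional functions in \<open>D\<close> make the set of tables
    finite.\<close>
  define M :: "(nat \<times> nat \<Rightarrow> nat) \<times> nat \<Rightarrow> nat monoid" where
    "M t = \<lparr>carrier = {..<N}, mult = \<lambda>x y. fst t (x, y), one = snd t\<rparr>" for t
  define D where "D = (({..<N} \<times> {..<N}) \<rightarrow>\<^sub>E {..<N}) \<times> {..<N}"
  have M: "\<exists>t\<in>D. H \<cong> M t" if "H \<in> S" for H
  proof -
    interpret group H using assms that by blast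
    have "card (carrier H) = N" "finite (carrier H)"
      using assms[OF that] by (auto simp: order_def)
    then obtain f where f: "bij_betw f (carrier H) {..<N}"
      using ex_bij_betw_finite_nat by (metis atLeast0LessThan)
    define g where "g = inv_into (carrier H) f"
    have g: "g x \<in> carrier H" if "x < N" for x
      using that f by (metis bij_betw_def g_def inv_into_into lessThan_iff)
    have fN: "f x < N" if "x \<in> carrier H" for x
      using that f by (auto dest: bij_betwE)
    have gf: "g (f x) = x" if "x \<in> carrier H" for x
      using that f by (simp add: g_def bij_betw_inv_into_left)
    define t where "t = (restrict (\<lambda>(x, y). f (g x \<otimes>\<^bsub>H\<^esub> g y)) ({..<N} \<times> {..<N}), f \<one>\<^bsub>H\<^esub>)"
    have "t \<in> D"
      by (auto simp: t_def D_def g fN)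
    moreover have "f \<in> iso H (M t)"
      using f by (auto simp: iso_def hom_def M_def t_def fN gf)
    ultimately show ?thesis
      by (auto intro: is_isoI)
  qed
  have "S // {(H, K). H \<in> S \<and> K \<in> S \<and> H \<cong> K} \<subseteq> (\<lambda>t. {K \<in> S. M t \<cong> K}) ` D"
  proof
    fix C assume "C \<in> S // {(H, K). H \<in> S \<and> K \<in> S \<and> H \<cong> K}"
    then obtain H where H: "H \<in> S" "C = {K \<in> S. H \<cong> K}"
      by (auto elim!: quotientE)
    obtain t where t: "t \<in> D" "H \<cong> M t"
      using M H(1) by blast
    \<comment> \<open>Symmetry of isomorphism is taken from the group \<open>H\<close>, so nothing
      has to be known about \<open>M t\<close>.\<close>
    have "M t \<cong> H"
      using t(2) assms H(1) group.iso_sym by blast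
    then have "C = {K \<in> S. M t \<cong> K}"
      using t(2) iso_trans unfolding H(2) by blast
    then show "C \<in> (\<lambda>t. {K \<in> S. M t \<cong> K}) ` D"
      using t(1) by blast
  qed
  moreover have "finite D"
    unfolding D_def by (intro finite_cartesian_product finite_PiE) auto
  ultimately show ?thesis
    by (meson finite_imageI finite_subset)
qed

text \<open>\<open>f\<close> induces an injection from the classes of \<open>T\<close> into those of
  \<open>S\<close>, and this injection misses the class of \<open>g\<close>.\<close>

lemma num_iso_classes_less:
  fixes S T :: "nat monoid set"
  assumes S: "\<And>H. H \<in> S \<Longrightarrow> group H \<and> finite (carrier H) \<and> order H = N"
    and T: "\<And>Q. Q \<in> T \<Longrightarrow> group Q"
    and f: "\<And>Q. Q \<in> T \<Longrightarrow> f Q \<in> S"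
    and inj: "\<And>Q R. \<lbrakk>Q \<in> T; R \<in> T; f Q \<cong> f R\<rbrakk> \<Longrightarrow> Q \<cong> R"
    and g: "g \<in> S" "\<And>Q. Q \<in> T \<Longrightarrow> \<not> g \<cong> f Q"
  shows "num_iso_classes T + 1 \<le> num_iso_classes S"
proof -
  define RS where "RS = {(H, K). H \<in> S \<and> K \<in> S \<and> H \<cong> K}"
  define RT where "RT = {(H, K). H \<in> T \<and> K \<in> T \<and> H \<cong> K}"
  have eqS: "equiv S RS" and eqT: "equiv T RT"
    using S T by (auto simp: RS_def RT_def intro!: equiv_iso)
  \<comment> \<open>\<open>f\<close> is not assumed to respect isomorphism, so the map on classes
    goes through a chosen representative.\<close>
  define rep where "rep C = (SOME Q. Q \<in> C)" for C :: "nat monoid set"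
  have rep: "rep C \<in> C" "rep C \<in> T" if "C \<in> T // RT" for C
  proof -
    show "rep C \<in> C"
      using in_quotient_imp_non_empty[OF eqT that] unfolding rep_def by (simp add: some_in_eq)
    then show "rep C \<in> T"
      using in_quotient_imp_subset[OF eqT that] by blast
  qed
  define h where "h C = RS `` {f (rep C)}" for C
  have "inj_on h (T // RT)"
  proof (rule inj_onI)
    fix C D assume C: "C \<in> T // RT" and D: "D \<in> T // RT" and "h C = h D"
    then have "(f (rep C), f (rep D)) \<in> RS"
      unfolding h_def using rep f by (simp add: eq_equiv_class_iff[OF eqS])
    then have "(rep C, rep D) \<in> RT"
      using inj rep C D by (simp add: RS_def RT_def)
    then show "C = D"
      using quotient_eqI[OF eqT C D] rep C D by blast
  qed
  moreover have "h ` (T // RT) \<subseteq> S // RS - {RS `` {g}}"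
  proof
    fix Y assume "Y \<in> h ` (T // RT)"
    then obtain C where C: "C \<in> T // RT" "Y = RS `` {f (rep C)}"
      by (auto simp: h_def)
    have "Y \<noteq> RS `` {g}"
      using eq_equiv_class_iff[OF eqS g(1) f[OF rep(2)[OF C(1)]]] g(2) rep(2)[OF C(1)]
      unfolding C(2) by (auto simp: RS_def)
    then show "Y \<in> S // RS - {RS `` {g}}"
      using C rep f by (auto intro: quotientI)
  qed
  moreover have "finite (S // RS)"
    unfolding RS_def using S by (rule finite_iso_classes)
  ultimately have "card (T // RT) \<le> card (S // RS - {RS `` {g}})"
    by (meson card_inj_on_le finite_Diff)
  \<comment> \<open>Positivity makes the truncated subtraction exact, which yields the extra
    1.\<close>
  moreover have "card (S // RS - {RS `` {g}}) = card (S // RS) - 1" "card (S // RS) > 0"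
    using g(1) \<open>finite (S // RS)\<close> quotientI[of g S RS] by (auto simp: card_gt_0_iff)
  ultimately show ?thesis
    by (simp add: num_iso_classes_def RS_def RT_def)
qed

subsection \<open>Cycle types of permutations\<close>

lemma dvd_of_dvd_prime_mult:
  fixes d r s :: nat
  assumes "prime r" "d dvd r * s" "\<not> d dvd s"
  shows "r dvd d"
  using assms by (metis coprime_commute coprime_dvd_mult_right_iff prime_imp_coprime)

text \<open>A point moved by \<open>x ^^ s\<close> lies on a cycle of length divisible by
  \<open>r\<close>, a point moved by \<open>x ^^ r\<close> on one of length divisible by
  \<open>s\<close>. Disjoint cycles need \<open>r + s\<close> points; a common cycle needs
  \<open>r * s\<close>, which is no less.\<close>

lemma permutes_sum_primes_le_card:
  fixes x :: "'a \<Rightarrow> 'a" and r s :: nat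
  assumes x: "x permutes A" and A: "finite A" and r: "prime r" and s: "prime s" and rs: "r \<noteq> s"
    and pow: "x ^^ (r * s) = id" and xr: "x ^^ r \<noteq> id" and xs: "x ^^ s \<noteq> id"
  shows "r + s \<le> card A"
proof -
  have perm: "permutation x"
    using x A by (auto simp: permutation_permutes)
  obtain a where a: "(x ^^ s) a \<noteq> a" using xs by (metis eq_id_iff)
  obtain b where b: "(x ^^ r) b \<noteq> b" using xr by (metis eq_id_iff)
  \<comment> \<open>\<open>?d c\<close> is the length of the cycle of \<open>x\<close> through
    \<open>c\<close>, and \<open>?O c\<close> is its set of points.\<close>
  let ?d = "least_power x" and ?O = "\<lambda>c. set (support x c)"
  have dvd: "?d c dvd r * s" for c
    using pow by (simp add: least_power_dvd[OF perm])
  have ra: "r dvd ?d a"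
    using dvd_of_dvd_prime_mult[OF r dvd] a by (simp add: least_power_dvd[OF perm])
  have sb: "s dvd ?d b"
    using dvd_of_dvd_prime_mult[OF s, of "?d b" r] dvd[of b] b
    by (simp add: least_power_dvd[OF perm] mult.commute)
  have card: "card (?O c) = ?d c" for c
    using distinct_card[OF cycle_of_permutation[OF perm, of c]] by simp
  have sub: "?O c \<subseteq> A" if "c \<in> A" for c
    using that permutes_in_image[OF permutes_funpow[OF x]] by auto
  have aA: "a \<in> A" and bA: "b \<in> A"
    using a b permutes_not_in[OF permutes_funpow[OF x]] by metis+
  show ?thesis
  proof (cases "?O a \<inter> ?O b = {}")
    case True
    have "r + s \<le> ?d a + ?d b"
      using ra sb least_power_of_permutation(2)[OF perm] by (intro add_mono dvd_imp_le) auto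
    also have "\<dots> = card (?O a \<union> ?O b)"
      using True by (simp only: card_Un_disjoint finite_set card)
    also have "\<dots> \<le> card A"
      using sub aA bA A by (intro card_mono) auto
    finally show ?thesis .
  next
    case False
    \<comment> \<open>Orbits partition the points, so two that meet coincide.\<close>
    then have "?O a = ?O b"
      using disjoint_support[OF perm] by (meson UNIV_I disjoint_def image_iff)
    then have "?d a = ?d b"
      using card by metis
    then have "r * s dvd ?d a"
      using ra sb r s rs by (simp add: divides_mult primes_coprime)
    then have "r * s \<le> ?d a"
      using least_power_of_permutation(2)[OF perm] by (intro dvd_imp_le) auto
    also have "?d a \<le> card A"
      using card_mono[OF A sub[OF aA]] card by metis
    finally have "r * s \<le> card A" .
    moreover have "r + s \<le> r * s"
    proof -
      obtain i j where "r = i + 2" "s = j + 2"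
        using prime_ge_2_nat[OF r] prime_ge_2_nat[OF s] by (metis le_add_diff_inverse2)
      then show ?thesis by (simp add: algebra_simps)
    qed
    ultimately show ?thesis by simp
  qed
qed

section \<open>Explicit elements of order \<open>r * s\<close> in alternating groups\<close>

lemma evenperm_funpow:
  assumes "permutation x"
  shows "evenperm (x ^^ k) \<longleftrightarrow> evenperm x \<or> even k"
  by (induct k) (auto simp: evenperm_comp assms permutation_funpow simp del: o_apply)

text \<open>The power of the cycle to its odd length is the identity, hence even; an odd power is
  even only if its base is.\<close>

lemma odd_cycle_in_alt_group:
  assumes "distinct cs" "odd (length cs)" "set cs \<subseteq> {1..n}"
  shows "cycle_of_list cs \<in> carrier (alt_group n)"
  using assms permutes_subset[OF cycle_permutes]
    evenperm_funpow[OF permutation_of_cycle, of "length cs" cs] cycle_is_id_root[of cs]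
  by (auto simp: alt_group_carrier)

lemma cycle_of_list_neq_id:
  assumes "distinct cs" "length cs \<ge> 2"
  shows "cycle_of_list cs \<noteq> id"
proof
  assume "cycle_of_list cs = id"
  \<comment> \<open>A cycle acts on its own list as a rotation by one place.\<close>
  then have "rotate1 cs = cs"
    using cyclic_rotation[OF assms(1), of 1] by simp
  moreover obtain a b ds where "cs = a # b # ds"
    using assms(2) by (metis Suc_le_length_iff numeral_2_eq_2)
  ultimately show False
    using assms(1) by auto
qed

lemma permutes_disjoint_comp_commute:
  assumes "x permutes A" "y permutes B" "A \<inter> B = {}"
  shows "x \<circ> y = y \<circ> x"
proof
  fix i
  have "x i = i \<or> i \<in> A \<and> x i \<in> A" "y i = i \<or> i \<in> B \<and> y i \<in> B"
    using assms(1,2) by (metis permutes_in_image permutes_not_in)+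
  moreover have "x j = j" if "j \<in> B" for j
    using that assms by (metis disjoint_iff permutes_not_in)
  moreover have "y j = j" if "j \<in> A" for j
    using that assms by (metis disjoint_iff permutes_not_in)
  ultimately show "(x \<circ> y) i = (y \<circ> x) i"
    by (metis comp_apply)
qed

lemma alt_group_pow: "x [^]\<^bsub>alt_group n\<^esub> (k :: nat) = x ^^ k"
  by (induct k) (simp_all add: nat_pow_def alt_group_def sym_group_def funpow_swap1 fun_eq_iff)

lemma sym_group_pow: "x [^]\<^bsub>sym_group n\<^esub> (k :: nat) = x ^^ k"
  by (induct k) (simp_all add: nat_pow_def sym_group_def funpow_swap1 fun_eq_iff)

lemma alt_group_ord_mult:
  assumes "x \<in> carrier (alt_group n)" "y \<in> carrier (alt_group n)" "x \<circ> y = y \<circ> x"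
    and "prime r" "prime s" "r \<noteq> s"
    and "x ^^ r = id" "x \<noteq> id" "y ^^ s = id" "y \<noteq> id"
  shows "\<exists>z\<in>carrier (alt_group n). group.ord (alt_group n) z = r * s"
proof -
  interpret A: group "alt_group n" by (rule alt_group_is_group)
  have "A.ord x = r" "A.ord y = s"
    using assms by (auto intro!: A.ord_eq_prime simp: alt_group_pow alt_group_one)
  then have "A.ord (x \<circ> y) = r * s"
    using A.ord_mult_coprime[of x y] assms by (simp add: alt_group_mult primes_coprime)
  then show ?thesis
    using A.m_closed[OF assms(1,2)] by (auto simp: alt_group_mult)
qed

lemma alt_group_ex_ord_odd_primes:
  assumes "prime r" "prime s" "odd r" "odd s" "r \<noteq> s" "r + s \<le> n"
  shows "\<exists>z\<in>carrier (alt_group n). group.ord (alt_group n) z = r * s"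
proof -
  \<comment> \<open>The witness is a product of an \<open>r\<close>-cycle and an
    \<open>s\<close>-cycle on adjacent blocks of \<open>r + s\<close> points.\<close>
  define cs where "cs = [1..<Suc r]"
  define ds where "ds = [Suc r..<Suc (r + s)]"
  have len: "length cs = r" "length ds = s" and dist: "distinct cs" "distinct ds"
    by (auto simp: cs_def ds_def)
  have sets: "set cs \<subseteq> {1..n}" "set ds \<subseteq> {1..n}" "set cs \<inter> set ds = {}"
    using assms(6) by (auto simp: cs_def ds_def)
  show ?thesis
  proof (rule alt_group_ord_mult)
    show "cycle_of_list cs \<circ> cycle_of_list ds = cycle_of_list ds \<circ> cycle_of_list cs"
      using dist sets(3) by (rule cycles_commute)
    show "cycle_of_list cs ^^ r = id" "cycle_of_list ds ^^ s = id"
      using cycle_is_id_root[OF dist(1)] cycle_is_id_root[OF dist(2)] len by auto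
    show "cycle_of_list cs \<noteq> id" "cycle_of_list ds \<noteq> id"
      using assms(1,2) dist len by (auto dest: cycle_of_list_neq_id prime_ge_2_nat)
    show "cycle_of_list cs \<in> carrier (alt_group n)" "cycle_of_list ds \<in> carrier (alt_group n)"
      using assms(3,4) dist len sets by (auto intro!: odd_cycle_in_alt_group)
  qed (use assms in auto)
qed

lemma alt_group_ex_ord_two:
  assumes "prime r" "odd r" "r + 4 \<le> n"
  shows "\<exists>z\<in>carrier (alt_group n). group.ord (alt_group n) z = 2 * r"
proof -
  define cs where "cs = [1..<Suc r]"
  \<comment> \<open>An involution in the alternating group must be even, so two transpositions are
    used. They occupy the four points beyond the \<open>r\<close>-cycle, whence the bound
    \<open>r + 4 \<le> n\<close>.\<close>
  define y where "y = transpose (r + 1) (r + 2) \<circ> transpose (r + 3) (r + 4)"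
  have len: "length cs = r" and dist: "distinct cs" and set: "set cs \<subseteq> {1..n}"
    using assms(3) by (auto simp: cs_def)
  have y: "y permutes {r + 1..r + 4}"
    unfolding y_def by (intro permutes_compose permutes_swap_id) auto
  have ev: "evenperm y"
    by (simp add: y_def evenperm_comp permutation_swap_id evenperm_swap)
  have "\<exists>z\<in>carrier (alt_group n). group.ord (alt_group n) z = r * 2"
  proof (rule alt_group_ord_mult)
    have "set cs \<inter> {r + 1..r + 4} = {}"
      by (auto simp: cs_def)
    then show "cycle_of_list cs \<circ> y = y \<circ> cycle_of_list cs"
      by (rule permutes_disjoint_comp_commute[OF cycle_permutes y])
    show "cycle_of_list cs ^^ r = id"
      using cycle_is_id_root[OF dist] len by auto
    show "y ^^ 2 = id"
      by (auto simp: y_def fun_eq_iff numeral_2_eq_2 transpose_def)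
    have "y (r + 1) \<noteq> r + 1"
      by (simp add: y_def transpose_def)
    then show "y \<noteq> id"
      by auto
    show "cycle_of_list cs \<noteq> id"
      using assms(1) dist len by (auto dest: cycle_of_list_neq_id prime_ge_2_nat)
    show "cycle_of_list cs \<in> carrier (alt_group n)"
      using assms(2) dist len set by (auto intro!: odd_cycle_in_alt_group)
    show "y \<in> carrier (alt_group n)"
      using permutes_subset[OF y, of "{1..n}"] assms(3) ev by (auto simp: alt_group_carrier)
  qed (use assms in auto)
  then show ?thesis
    by (simp add: mult.commute)
qed

lemma alt_group_ex_ord:
  assumes "prime r" "prime s" "r \<noteq> s" "r + 4 \<le> n" "s + 4 \<le> n" "r = 2 \<or> s = 2 \<or> r + s \<le> n"
  shows "\<exists>z\<in>carrier (alt_group n). group.ord (alt_group n) z = r * s"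
proof -
  have "odd q" if "prime q" "q \<noteq> 2" for q :: nat
    using that prime_odd_nat[of q] prime_ge_2_nat[of q] by fastforce
  then show ?thesis
    using assms alt_group_ex_ord_odd_primes[of r s n] alt_group_ex_ord_two[of s n]
      alt_group_ex_ord_two[of r n] by (metis mult.commute)
qed

subsection \<open>Alternating and symmetric groups\<close>

text \<open>Both families are treated at once: what matters is that \<open>F n\<close> lies between
  the alternating and the symmetric group, and how its order grows with the degree.\<close>

locale alt_or_sym =
  fixes F :: "nat \<Rightarrow> (nat \<Rightarrow> nat) monoid"
  assumes F_cases: "F = alt_group \<or> F = sym_group"
begin

lemma is_group: "group (F n)"
  using F_cases alt_group_is_group sym_group_is_group by auto

sublocale F: group "F n" for n
  by (rule is_group)

lemma F_mult: "mult (F n) = (\<circ>)"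
  using F_cases alt_group_mult sym_group_mult by auto

lemma F_one: "one (F n) = id"
  using F_cases alt_group_one sym_group_one by auto

lemma F_pow: "x [^]\<^bsub>F n\<^esub> (k :: nat) = x ^^ k"
  using F_cases alt_group_pow sym_group_pow by auto

lemma F_permutes: "x \<in> carrier (F n) \<Longrightarrow> x permutes {1..n}"
  using F_cases by (auto simp: alt_group_carrier sym_group_carrier)

lemma alt_subset_F: "carrier (alt_group n) \<subseteq> carrier (F n)"
  using F_cases by (auto simp: alt_group_carrier sym_group_carrier)

lemma F_finite: "finite (carrier (F n))"
  by (rule finite_subset[OF _ finite_permutations[of "{1..n}"]]) (auto dest: F_permutes)

lemma order_F_Suc:
  assumes "k \<ge> 2"
  shows "order (F (Suc k)) = Suc k * order (F k)"
  using F_cases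
proof
  assume F: "F = alt_group"
  \<comment> \<open>Doubling avoids the division in \<open>fact n / 2\<close>. The bound
    \<open>k \<ge> 2\<close> is needed because the alternating group of degree 1 does not have half
    the order of the symmetric group.\<close>
  have "2 * order (F (Suc k)) = 2 * (Suc k * order (F k))"
    using alt_group_card_carrier[of k] alt_group_card_carrier[of "Suc k"] assms
    by (simp add: F order_def algebra_simps)
  then show ?thesis by simp
qed (simp add: order_def sym_group_card_carrier)

section \<open>Prime graphs of \<open>F n\<close> and of its direct products with 5-groups\<close>

lemma group_primes_F_le:
  assumes "q \<in> group_primes (F n)" "n \<ge> 2"
  shows "q \<le> n"
proof -
  have "order (F n) dvd fact n"
    using F_cases alt_group_card_carrier[OF assms(2)] sym_group_card_carrier[of n]
    by (auto simp: order_def) (metis dvd_triv_right)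
  then show ?thesis
    using assms(1) by (auto simp: group_primes_def prime_dvd_fact_iff dest: dvd_trans)
qed

lemma F_ex_ord:
  assumes "prime r" "prime s" "r \<noteq> s" "r + 4 \<le> n" "s + 4 \<le> n" "r = 2 \<or> s = 2 \<or> r + s \<le> n"
  shows "\<exists>z\<in>carrier (F n). F.ord n z = r * s"
proof -
  obtain z where z: "z \<in> carrier (alt_group n)" "group.ord (alt_group n) z = r * s"
    using alt_group_ex_ord[OF assms] by blast
  have "id \<in> hom (alt_group n) (F n)"
    using alt_subset_F[of n] by (auto simp: hom_def F_mult subset_iff alt_group_mult)
  from ord_inj_hom[OF this _ alt_group_is_group is_group z(1)] show ?thesis
    using z alt_subset_F[of n] by auto
qed

lemma ord_F_sum_le:
  assumes z: "z \<in> carrier (F n)" "F.ord n z = r * s" and "prime r" "prime s" "r \<noteq> s"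
  shows "r + s \<le> n"
proof -
  have pow: "z ^^ k = id \<longleftrightarrow> r * s dvd k" for k
    using F.pow_eq_id[OF z(1), of k] z(2) by (simp add: F_pow F_one)
  \<comment> \<open>Thus neither \<open>z ^^ r\<close> nor \<open>z ^^ s\<close> is the identity, as
    the cycle count requires.\<close>
  have "\<not> r * s dvd r" "\<not> r * s dvd s"
    using assms(3,4) by (auto dest!: dvd_imp_le dest: prime_gt_0_nat prime_gt_1_nat)
  then have "r + s \<le> card {1..n}"
    using F_permutes[OF z(1)] assms(3-5) pow by (intro permutes_sum_primes_le_card[of z]) auto
  then show ?thesis by simp
qed

lemma prime_graph_adj_F:
  assumes "n \<ge> 2" "\<And>q. \<lbrakk>prime q; q \<le> n\<rbrakk> \<Longrightarrow> q + 4 \<le> n"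
  shows "prime_graph_adj (F n) r s \<longleftrightarrow> r \<in> group_primes (F n) \<and> s \<in> group_primes (F n) \<and> r \<noteq> s \<and>
    (r = 2 \<or> s = 2 \<or> r + s \<le> n)"
proof -
  have "prime q \<and> q + 4 \<le> n" if "q \<in> group_primes (F n)" for q
    using that assms group_primes_F_le by (auto simp: group_primes_def)
  then show ?thesis
    unfolding prime_graph_adj_def using F_ex_ord[of r s n] ord_F_sum_le[of _ n r s] by blast
qed

text \<open>The factor \<open>Q\<close> can only create edges at 5, and there the gap hypothesis
  already makes 5 adjacent to every other vertex. No edge is lost in degree \<open>k\<close>, by
  parity of \<open>Suc k\<close>.\<close>

lemma prime_graph_adj_DirProd:
  fixes Q :: "'a monoid"
  assumes Q: "group Q" "finite (carrier Q)" "order Q = 5 ^ a"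
    and n: "Suc k = 5 ^ a"
    and k: "k \<ge> 2" and gap: "\<And>q. \<lbrakk>prime q; q \<le> Suc k\<rbrakk> \<Longrightarrow> q + 5 \<le> Suc k"
  shows "prime_graph_adj (F k \<times>\<times> Q) = prime_graph_adj (F (Suc k))"
proof (intro ext)
  fix r s
  interpret Q: group Q by fact
  interpret P: group "F k \<times>\<times> Q" using is_group Q(1) by (rule DirProd_group)
  have "order (F k \<times>\<times> Q) = order (F (Suc k))"
    unfolding order_F_Suc[OF k] using Q(3) n by (simp add: order_def card_cartesian_product)
  then have primes: "group_primes (F k \<times>\<times> Q) = group_primes (F (Suc k))"
    by (simp add: group_primes_def)
  have incl: "P.ord (x, \<one>\<^bsub>Q\<^esub>) = F.ord k x" if "x \<in> carrier (F k)" for x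
    using that ord_inj_hom[of "\<lambda>x. (x, \<one>\<^bsub>Q\<^esub>)" "F k" "F k \<times>\<times> Q" x] is_group P.is_group
    by (auto simp: hom_def inj_on_def)
  show "prime_graph_adj (F k \<times>\<times> Q) r s = prime_graph_adj (F (Suc k)) r s"
  proof (cases "r \<in> group_primes (F (Suc k)) \<and> s \<in> group_primes (F (Suc k)) \<and> r \<noteq> s")
    case True
    then have pr: "prime r" "prime s" "r \<noteq> s" and le: "r + 5 \<le> Suc k" "s + 5 \<le> Suc k"
      using gap group_primes_F_le[of _ "Suc k"] k by (auto simp: group_primes_def)
    have "odd (Suc k)" unfolding n by simp
    have gap4: "q + 4 \<le> Suc k" if "prime q" "q \<le> Suc k" for q
      using gap[OF that] by simp
    have adj: "prime_graph_adj (F (Suc k)) r s \<longleftrightarrow> r = 2 \<or> s = 2 \<or> r + s \<le> Suc k"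
      using prime_graph_adj_F[OF _ gap4, of r s] True k by auto
    \<comment> \<open>The sum of two odd primes is even and cannot equal the odd number
      \<open>Suc k\<close>.\<close>
    have sum: "r + s \<le> k" if "r + s \<le> Suc k" "r \<noteq> 2" "s \<noteq> 2"
    proof -
      have "odd r" "odd s"
        using pr that(2,3) prime_odd_nat prime_ge_2_nat by (metis le_neq_implies_less)+
      then have "r + s \<noteq> Suc k"
        using \<open>odd (Suc k)\<close> by (metis odd_even_add)
      then show ?thesis using that(1) by simp
    qed
    have "(\<exists>x\<in>carrier (F k \<times>\<times> Q). P.ord x = r * s) \<longleftrightarrow> r = 2 \<or> s = 2 \<or> r + s \<le> Suc k"
    proof
      assume "r = 2 \<or> s = 2 \<or> r + s \<le> Suc k"
      \<comment> \<open>The bound \<open>q + 5 \<le> Suc k\<close> is exactly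
        \<open>q + 4 \<le> k\<close>, the room for a double transposition in degree
        \<open>k\<close>.\<close>
      then obtain z where "z \<in> carrier (F k)" "F.ord k z = r * s"
        using F_ex_ord[of r s k] pr le sum by auto
      then have "(z, \<one>\<^bsub>Q\<^esub>) \<in> carrier (F k \<times>\<times> Q)" "P.ord (z, \<one>\<^bsub>Q\<^esub>) = r * s"
        using incl by auto
      then show "\<exists>x\<in>carrier (F k \<times>\<times> Q). P.ord x = r * s" by blast
    next
      assume "\<exists>x\<in>carrier (F k \<times>\<times> Q). P.ord x = r * s"
      then obtain x y where xy: "x \<in> carrier (F k)" "y \<in> carrier Q" "P.ord (x, y) = r * s"
        by auto
      show "r = 2 \<or> s = 2 \<or> r + s \<le> Suc k"
      \<comment> \<open>If 5 is one of the two primes, the gap bound for the other is the claim.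
        Otherwise \<open>y\<close> has exponent prime to 5 in a 5-group, so it is trivial and
        \<open>x\<close> carries the whole order.\<close>
      proof (cases "r = 5 \<or> s = 5")
        case False
        have "coprime (r * s) (order Q)"
          using False pr unfolding Q(3) by (auto intro!: coprime_power_right_iff[THEN iffD2] primes_coprime)
        moreover have "snd \<in> hom (F k \<times>\<times> Q) Q"
          by (auto simp: hom_def)
        then have "y [^]\<^bsub>Q\<^esub> (r * s) = \<one>\<^bsub>Q\<^esub>"
          using hom_nat_pow[of snd "F k \<times>\<times> Q" Q "(x, y)" "r * s"] P.pow_ord_eq_1[of "(x, y)"]
            P.is_group Q(1) xy by simp
        ultimately have "y = \<one>\<^bsub>Q\<^esub>"
          using Q.eq_one_if_pow_coprime_order Q(2) xy(2) by blast
        then have "r + s \<le> k"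
          using xy incl ord_F_sum_le[of x k r s] pr by simp
        then show ?thesis by simp
      qed (use le in auto)
    qed
    then show ?thesis
      using True adj unfolding prime_graph_adj_def primes by blast
  qed (auto simp: prime_graph_adj_def primes)
qed

section \<open>Homomorphisms to groups of order coprime to 6, and recovery of the factor
  \<open>Q\<close>\<close>

lemma hom_F_trivial:
  assumes Q: "group Q" "finite (carrier Q)" "coprime 6 (order Q)"
    and h: "h \<in> hom (F n) Q" and x: "x \<in> carrier (F n)"
  shows "h x = \<one>\<^bsub>Q\<^esub>"
proof -
  interpret Q: group Q by fact
  interpret A: group "alt_group n" by (rule alt_group_is_group)
  have "h \<in> hom (alt_group n) Q"
    using h alt_subset_F[of n] by (auto simp: hom_def F_mult subset_iff alt_group_mult)
  then interpret h: group_hom "alt_group n" Q h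
    by unfold_locales
  have cop: "coprime 2 (order Q)" "coprime 3 (order Q)"
    using Q(3) coprime_mult_left_iff[of 2 3 "order Q"] by auto
  \<comment> \<open>The image of a 3-cycle has trivial cube, hence is trivial in a group of order
    coprime to 3. As 3-cycles generate the alternating group, \<open>h\<close> kills it.\<close>
  have "three_cycles n \<subseteq> kernel (alt_group n) Q h"
  proof
    fix c assume c: "c \<in> three_cycles n"
    then have cA: "c \<in> carrier (alt_group n)"
      using three_cycles_incl by blast
    have "c ^^ 3 = id"
      using c cycle_is_id_root by fastforce
    then have "h c [^]\<^bsub>Q\<^esub> (3 :: nat) = \<one>\<^bsub>Q\<^esub>"
      using h.hom_nat_pow[OF cA, of 3] h.hom_one by (simp add: alt_group_pow alt_group_one)
    then show "c \<in> kernel (alt_group n) Q h"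
      using cA cop(2) Q(2) Q.eq_one_if_pow_coprime_order[of "h c" 3] by (simp add: kernel_def)
  qed
  then have alt: "h y = \<one>\<^bsub>Q\<^esub>" if "y \<in> carrier (alt_group n)" for y
    using that A.generate_subgroup_incl[OF _ h.subgroup_kernel]
    by (auto simp: alt_group_carrier_as_three_cycles kernel_def)
  have perm: "permutation x"
    using F_permutes[OF x] by (auto simp: permutation_permutes)
  \<comment> \<open>The square of any permutation is even, so \<open>h x\<close> squares to the unit
    in a group of odd order.\<close>
  have "x \<circ> x \<in> carrier (alt_group n)"
    using F_permutes[OF x] evenperm_comp[OF perm perm] by (simp add: alt_group_carrier permutes_compose)
  then have "h x [^]\<^bsub>Q\<^esub> (2 :: nat) = \<one>\<^bsub>Q\<^esub>"
    using alt h x hom_mult[of h "F n" Q x x] hom_in_carrier[OF h x]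
    by (simp add: F_mult numeral_2_eq_2)
  then show ?thesis
    using Q.eq_one_if_pow_coprime_order[OF Q(2)] hom_in_carrier[OF h x] cop(1) by blast
qed

text \<open>The composite from \<open>F k\<close> to \<open>R\<close> is trivial, so
  \<open>f\<close> carries the factor \<open>F k\<close> into the factor \<open>F k\<close>, and
  onto it by counting. What remains of \<open>f\<close> is an isomorphism between the complementary
  factors.\<close>

lemma DirProd_cancel:
  assumes Q: "group Q" "finite (carrier Q)" "coprime 6 (order Q)"
    and R: "group R" "finite (carrier R)" "order R = order Q"
    and iso: "F k \<times>\<times> Q \<cong> F k \<times>\<times> R"
  shows "Q \<cong> R"
proof -
  interpret Q: group Q by fact
  interpret R: group R by fact
  obtain f where f: "f \<in> hom (F k \<times>\<times> Q) (F k \<times>\<times> R)" "inj_on f (carrier (F k \<times>\<times> Q))"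
    using iso by (auto simp: is_iso_def iso_iff)
  have snd: "snd \<circ> f \<in> hom (F k \<times>\<times> Q) R"
    using f(1) by (simp add: hom_pairwise)
  have fF: "snd (f (x, \<one>\<^bsub>Q\<^esub>)) = \<one>\<^bsub>R\<^esub>" if "x \<in> carrier (F k)" for x
  proof -
    have "(\<lambda>x. (x, \<one>\<^bsub>Q\<^esub>)) \<in> hom (F k) (F k \<times>\<times> Q)"
      by (auto simp: hom_def)
    from hom_F_trivial[OF R(1,2) _ hom_compose[OF this snd] that] show ?thesis
      using Q(3) R(3) by simp
  qed
  let ?M = "carrier (F k) \<times> {\<one>\<^bsub>Q\<^esub>}" and ?Y = "carrier (F k) \<times> {\<one>\<^bsub>R\<^esub>}"
  have inj: "inj_on f ?M"
    using f(2) by (rule inj_on_subset) auto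
  have sub: "f ` ?M \<subseteq> ?Y"
    using fF hom_in_carrier[OF f(1)] by (auto simp: image_subset_iff mem_Times_iff)
  have "card (f ` ?M) = card ?Y"
    using card_image[OF inj] by (simp add: card_cartesian_product)
  then have fM: "f ` ?M = ?Y"
    using card_subset_eq[OF _ sub] F_finite by blast
  define g where "g y = snd (f (\<one>\<^bsub>F k\<^esub>, y))" for y
  have "(\<lambda>y. (\<one>\<^bsub>F k\<^esub>, y)) \<in> hom Q (F k \<times>\<times> Q)"
    by (auto simp: hom_def)
  from hom_compose[OF this snd] have g: "g \<in> hom Q R"
    by (simp add: g_def[abs_def] comp_def)
  then interpret g: group_hom Q R g
    by unfold_locales
  have "y = \<one>\<^bsub>Q\<^esub>" if y: "y \<in> carrier Q" "g y = \<one>\<^bsub>R\<^esub>" for y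
  proof -
    \<comment> \<open>An element of the kernel of \<open>g\<close> lands in the image of the first
      factor; injectivity of \<open>f\<close> pulls it back there.\<close>
    have "f (\<one>\<^bsub>F k\<^esub>, y) \<in> ?Y"
      using y hom_in_carrier[OF f(1), of "(\<one>\<^bsub>F k\<^esub>, y)"] by (simp add: g_def mem_Times_iff)
    then have "f (\<one>\<^bsub>F k\<^esub>, y) \<in> f ` ?M"
      using fM by simp
    then have "(\<one>\<^bsub>F k\<^esub>, y) \<in> ?M"
      using f(2) y(1) by (subst (asm) inj_on_image_mem_iff[of f "carrier (F k \<times>\<times> Q)"]) auto
    then show ?thesis by simp
  qed
  then have "inj_on g (carrier Q)"
    by (intro g.inj_on_one_iff[THEN iffD2]) auto
  moreover have "g ` carrier Q = carrier R"
    using R(2,3) hom_carrier[OF g] card_image[OF \<open>inj_on g (carrier Q)\<close>]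
    by (intro card_subset_eq) (auto simp: order_def)
  ultimately have "g \<in> iso Q R"
    using g by (simp only: iso_iff simp_thms)
  then show ?thesis
    by (rule is_isoI)
qed

text \<open>An isomorphism followed by the projection to \<open>Q\<close> would be surjective, yet
  it is trivial.\<close>

lemma not_iso_DirProd:
  assumes Q: "group Q" "finite (carrier Q)" "coprime 6 (order Q)" "order Q \<noteq> 1"
  shows "\<not> F n \<cong> F k \<times>\<times> Q"
proof
  interpret Q: group Q by fact
  assume "F n \<cong> F k \<times>\<times> Q"
  then obtain f where f: "f \<in> hom (F n) (F k \<times>\<times> Q)" "f ` carrier (F n) = carrier (F k \<times>\<times> Q)"
    by (auto simp: is_iso_def iso_iff)
  have "snd \<circ> f \<in> hom (F n) Q"
    using f(1) by (simp add: hom_pairwise)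
  from hom_F_trivial[OF Q(1-3) this] have one: "snd (f x) = \<one>\<^bsub>Q\<^esub>" if "x \<in> carrier (F n)" for x
    using that by simp
  have "y = \<one>\<^bsub>Q\<^esub>" if "y \<in> carrier Q" for y
  proof -
    have "(\<one>\<^bsub>F k\<^esub>, y) \<in> f ` carrier (F n)"
      unfolding f(2) using that by simp
    then obtain x where x: "x \<in> carrier (F n)" "(\<one>\<^bsub>F k\<^esub>, y) = f x"
      by (rule imageE)
    then show ?thesis
      using one[OF x(1)] by (simp flip: x(2))
  qed
  then have "carrier Q = {\<one>\<^bsub>Q\<^esub>}"
    by auto
  then show False
    using Q(4) by (simp add: order_def)
qed

section \<open>The lower bound for \<open>h_OD\<close>\<close>

lemma num_groups_less_h_OD:
  assumes n: "Suc k = 5 ^ a" and k: "k \<ge> 2"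
    and gap: "\<And>q. \<lbrakk>prime q; q \<le> Suc k\<rbrakk> \<Longrightarrow> q + 5 \<le> Suc k"
  shows "num_groups_of_order (5 ^ a) + 1 \<le> h_OD (F (Suc k))"
proof -
  let ?T = "{Q :: nat monoid. group Q \<and> finite (carrier Q) \<and> order Q = 5 ^ a}"
  let ?S = "{H :: nat monoid. group H \<and> finite (carrier H) \<and> order H = order (F (Suc k)) \<and>
     degree_pattern H = degree_pattern (F (Suc k))}"
  \<comment> \<open>The carrier type is left arbitrary because this is applied to permutations and
    to pairs.\<close>
  have copy: "\<exists>H\<in>?S. G \<cong> H"
    if "group G" "finite (carrier G)" "order G = order (F (Suc k))"
      "prime_graph_adj G = prime_graph_adj (F (Suc k))" for G :: "'b monoid"
  proof -
    obtain H :: "nat monoid" where H: "group H" "finite (carrier H)" "G \<cong> H"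
      using ex_iso_nat_group[OF \<open>group G\<close> \<open>finite (carrier G)\<close>] by blast
    have "order H = order (F (Suc k))"
      using iso_same_card[OF H(3)] that(3) by (simp add: order_def)
    moreover have "prime_graph_adj H = prime_graph_adj (F (Suc k))"
      using iso_imp_prime_graph_adj_eq[OF H(3) \<open>group G\<close> H(1)] that(4) by simp
    ultimately show ?thesis
      using H degree_pattern_cong by blast
  qed
  obtain g where g: "g \<in> ?S" "F (Suc k) \<cong> g"
    using copy[OF is_group F_finite refl refl] by blast
  have "\<exists>H\<in>?S. F k \<times>\<times> Q \<cong> H" if "Q \<in> ?T" for Q
  proof (rule copy)
    show "order (F k \<times>\<times> Q) = order (F (Suc k))"
      unfolding order_F_Suc[OF k] using that n by (simp add: order_def card_cartesian_product)
    show "prime_graph_adj (F k \<times>\<times> Q) = prime_graph_adj (F (Suc k))"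
      using that n k gap by (intro prime_graph_adj_DirProd) auto
  qed (use that F_finite is_group DirProd_group in auto)
  then have "\<forall>Q\<in>?T. \<exists>H. H \<in> ?S \<and> F k \<times>\<times> Q \<cong> H"
    by blast
  then obtain f where "\<forall>Q\<in>?T. f Q \<in> ?S \<and> F k \<times>\<times> Q \<cong> f Q"
    unfolding bchoice_iff by (rule exE)
  then have f: "\<And>Q. Q \<in> ?T \<Longrightarrow> f Q \<in> ?S" "\<And>Q. Q \<in> ?T \<Longrightarrow> F k \<times>\<times> Q \<cong> f Q"
    by blast+
  have f': "f Q \<cong> F k \<times>\<times> Q" if "Q \<in> ?T" for Q
  proof -
    have "group (F k \<times>\<times> Q)"
      using that is_group by (intro DirProd_group) simp_all
    then show ?thesis
      using f(2)[OF that] by (rule group.iso_sym)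
  qed
  have cop: "coprime 6 (5 ^ a :: nat)"
    using coprime_Suc_left_nat[of 5] by (simp add: coprime_power_right_iff)
  have "num_iso_classes ?T + 1 \<le> num_iso_classes ?S"
  proof (rule num_iso_classes_less)
    show "Q \<cong> R" if "Q \<in> ?T" "R \<in> ?T" "f Q \<cong> f R" for Q R
    proof (rule DirProd_cancel)
      show "F k \<times>\<times> Q \<cong> F k \<times>\<times> R"
        by (rule iso_trans[OF f(2)[OF that(1)] iso_trans[OF that(3) f'[OF that(2)]]])
    qed (use that cop in auto)
    show "\<not> g \<cong> f Q" if "Q \<in> ?T" for Q
    proof
      assume "g \<cong> f Q"
      from iso_trans[OF g(2) iso_trans[OF this f'[OF that]]]
      have "F (Suc k) \<cong> F k \<times>\<times> Q" .
      \<comment> \<open>Here \<open>a = 0\<close> is excluded by \<open>k \<ge> 2\<close>, so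
        \<open>Q\<close> is nontrivial.\<close>
      then show False
        using not_iso_DirProd[of Q "Suc k" k] that cop n k by (cases a) auto
    qed
  qed (use f g in auto)
  then show ?thesis
    by (simp add: num_groups_of_order_def h_OD_def)
qed

end

theorem corollary1p11:
  fixes p \<alpha> m :: nat
  assumes "normalization_semidom_class.prime p" and "odd p"
    and "\<not> normalization_semidom_class.prime (p + 2)" and "\<not> normalization_semidom_class.prime (p + 4)"
    and "int p = 5 ^ \<alpha> - 6"
    and "m = num_groups_of_order (5 ^ \<alpha>)"
  shows "h_OD (alt_group (p + 6)) \<ge> m + 1 \<and> h_OD (sym_group (p + 6)) \<ge> m + 1"
proof -
  have "int (p + 6) = int (5 ^ \<alpha>)"
    using assms(5) by simp
  then have n: "p + 6 = 5 ^ \<alpha>"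
    by (simp only: of_nat_eq_iff)
  \<comment> \<open>The powers 1 and 5 are below 6, so \<open>p + 6\<close> is a proper power of 5
    and not prime.\<close>
  have "\<alpha> \<noteq> 0"
    using n by (intro notI) simp
  moreover have "\<alpha> \<noteq> 1"
    using n by (intro notI) simp
  ultimately have "\<not> prime (p + 6)"
    unfolding n by (simp add: prime_power_iff)
  \<comment> \<open>No prime lies strictly above \<open>p\<close> and at most \<open>p + 6\<close>:
    odd offsets give even numbers above 2, offsets 2 and 4 are excluded by hypothesis, and offset 6
    is the proper power.\<close>
  have gap: "q + 5 \<le> Suc (p + 5)" if "prime q" "q \<le> Suc (p + 5)" for q
  proof -
    have "p \<ge> 2"
      using assms(1) by (rule prime_ge_2_nat)
    have "q \<noteq> p + 1" "q \<noteq> p + 3" "q \<noteq> p + 5"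
      using \<open>prime q\<close> \<open>odd p\<close> \<open>p \<ge> 2\<close> prime_odd_nat[of q] by auto
    moreover have "q \<noteq> p + 2" "q \<noteq> p + 4" "q \<noteq> p + 6"
      using \<open>prime q\<close> assms(3,4) \<open>\<not> prime (p + 6)\<close> by auto
    ultimately show ?thesis
      using that(2) by linarith
  qed
  have "num_groups_of_order (5 ^ \<alpha>) + 1 \<le> h_OD (F (Suc (p + 5)))"
    if "alt_or_sym F" for F
    using that n gap by (intro alt_or_sym.num_groups_less_h_OD) auto
  from this[of alt_group] this[of sym_group] show ?thesis
    unfolding assms(6) by (simp add: alt_or_sym_def add.commute)
qed

end
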